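(* Let $X$ be a compactum and let $\nu\in MX$ be an (upper-semicontinuous) capacity on $X$. The core of $\nu$ is non-empty, i.e. there exists a probability measure $\mu$ on $X$ with $\mu(A)\ge\nu(A)$ for each closed subset $A\subset X$, if and only if $\nu$ is balanced.
   Context: A compactum is a compact Hausdorff space. For a compactum $X$, $\mathcal F(X)$ denotes the family of all closed subsets of $X$. An (upper-semicontinuous) capacity on $X$ is a function $\nu:\mathcal F(X)\to[0,1]$ such that for all closed $F,G\subset X$: (1) $\nu(X)=1$, $\nu(\emptyset)=0$; (2) if $F\subset G$ then $\nu(F)\le\nu(G)$; (3) if $\nu(F)<a$ then there is an open set $O\supset F$ such that $\nu(B)<a$ for each compact $B\subset O$. $MX$ denotes the set of all such capacities. A capacity $\nu\in MX$ is balanced if $\sum_{i=1}^n\lambda_i\nu(A_i)\le 1$ for all $n$, all non-negative real numbers $\lambda_1,\dots,\lambda_n$ and all closed subsets $A_1,\dots,A_n$ of $X$ such that $\sum_{i=1}^n\lambda_i\chi_{A_i}\le 1_X$ pointwise, where $\chi_{A}$ is the characteristic function of $A$ and $1_X$ is the constant function $1$. A probability measure on $X$ is a $\sigma$-additive regular Borel measure $\mu$ with $\mu(X)=1$. A probability measure $\mu$ belongs to the core of $\nu\in MX$ if $\mu(A)\ge\nu(A)$ for each closed subset $A$ of $X$. *)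

theory Defs
  imports "HOL-Probability.Probability"
begin

text \<open>
  The compactum is the universe of a type of class \<^class>\<open>t2_space\<close> that is compact as a set;
  its closed sets are the closed sets of the type. The restriction to nonempty spaces is harmless:
  the empty space carries no capacity, since \<open>\<nu> X = 1\<close> and \<open>\<nu> {} = 0\<close> would contradict each other.

  A capacity is given as a total function on sets, but only its values on closed sets matter.
\<close>

definition usc_capacity :: "('a::t2_space set \<Rightarrow> real) \<Rightarrow> bool" where
  "usc_capacity \<nu> \<longleftrightarrow>
     (\<forall>F. closed F \<longrightarrow> 0 \<le> \<nu> F \<and> \<nu> F \<le> 1) \<and>
     \<nu> UNIV = 1 \<and> \<nu> {} = 0 \<and>
     (\<forall>F G. closed F \<longrightarrow> closed G \<longrightarrow> F \<subseteq> G \<longrightarrow> \<nu> F \<le> \<nu> G) \<and>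
     (\<forall>F a. closed F \<longrightarrow> \<nu> F < a \<longrightarrow>
        (\<exists>U. open U \<and> F \<subseteq> U \<and> (\<forall>B. compact B \<longrightarrow> B \<subseteq> U \<longrightarrow> \<nu> B < a)))"

definition balanced :: "('a::t2_space set \<Rightarrow> real) \<Rightarrow> bool" where
  "balanced \<nu> \<longleftrightarrow>
     (\<forall>(n::nat) (c :: nat \<Rightarrow> real) (A :: nat \<Rightarrow> 'a set).
        (\<forall>i\<in>{1..n}. 0 \<le> c i \<and> closed (A i)) \<longrightarrow>
        (\<forall>x. (\<Sum>i=1..n. c i * indicator (A i) x) \<le> 1) \<longrightarrow>
        (\<Sum>i=1..n. c i * \<nu> (A i)) \<le> 1)"

definition regular_borel_measure :: "'a::topological_space measure \<Rightarrow> bool" where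
  "regular_borel_measure \<mu> \<longleftrightarrow>
     sets \<mu> = sets borel \<and>
     (\<forall>B \<in> sets borel.
        emeasure \<mu> B = (SUP K \<in> {K. K \<subseteq> B \<and> compact K}. emeasure \<mu> K) \<and>
        emeasure \<mu> B = (INF U \<in> {U. B \<subseteq> U \<and> open U}. emeasure \<mu> U))"

definition core :: "('a::t2_space set \<Rightarrow> real) \<Rightarrow> 'a measure set" where
  "core \<nu> = {\<mu>. prob_space \<mu> \<and> regular_borel_measure \<mu> \<and>
                 (\<forall>A. closed A \<longrightarrow> \<nu> A \<le> measure \<mu> A)}"

end

theory Submission
  imports Defs
begin

text \<open>
  Extend \<open>\<nu>\<close> by \<open>0\<close> to all subsets. By Zorn's lemma it lies below a maximal balanced set
  function \<open>m\<close>. If \<open>m A + m (- A) < 1\<close>, one of the two values could be raised: otherwise there are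
  two families of weights witnessing the contrary, and a suitable combination of them, after cancelling
  \<open>A\<close> against \<open>- A\<close>, violates balancedness of \<open>m\<close>. So \<open>m A + m (- A) = 1\<close> for all \<open>A\<close>, and
  balancedness then forces \<open>m\<close> to be finitely additive. Such an \<open>m\<close> dominates \<open>\<nu>\<close> but in general is neither
  countably additive nor regular; the outer measure \<open>A \<mapsto> inf\<^sub>U sup\<^sub>K m K\<close>, with \<open>U \<supseteq> A\<close> open and
  \<open>K \<subseteq> U\<close> closed, only increases the values on closed sets, keeps total mass \<open>1\<close>, and restricts to
  a regular Borel measure by Caratheodory's theorem.
\<close>

section \<open>Balanced set functions and finitely additive majorants\<close>

text \<open>The Bondareva-Shapley condition for a game on all subsets. Families are indexed by the
  sets themselves, so each set carries one weight and raising a single value of \<open>w\<close>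
  changes a single summand.\<close>

definition balanced_game :: "('a set \<Rightarrow> real) \<Rightarrow> bool" where
  "balanced_game w \<longleftrightarrow>
     (\<forall>S c. finite S \<longrightarrow> (\<forall>A\<in>S. 0 \<le> c A) \<longrightarrow> (\<forall>x. (\<Sum>A\<in>S. c A * indicator A x) \<le> 1) \<longrightarrow>
        (\<Sum>A\<in>S. c A * w A) \<le> 1)"

text \<open>Homogeneity: the weights are divided by the bound. Since \<open>t\<close> may be
  \<open>0\<close>, the divisor is \<open>t + e\<close>, and \<open>e\<close> tends to
  \<open>0\<close> afterwards.\<close>

lemma balanced_game_sum_le:
  fixes w :: "'a set \<Rightarrow> real"
  assumes "balanced_game w" "finite S" and nonneg: "\<And>A. A \<in> S \<Longrightarrow> 0 \<le> c A"
    and bound: "\<And>x. (\<Sum>A\<in>S. c A * indicator A x) \<le> t"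
  shows "(\<Sum>A\<in>S. c A * w A) \<le> t"
proof (rule field_le_epsilon)
  fix e :: real assume "0 < e"
  have "0 \<le> t"
    using order_trans[OF sum_nonneg bound] nonneg by (simp add: indicator_def)
  then have te: "0 < t + e" using \<open>0 < e\<close> by simp
  have "(\<Sum>A\<in>S. (c A / (t + e)) * w A) \<le> 1"
  proof (rule assms(1)[unfolded balanced_game_def, rule_format, OF assms(2)])
    show "(\<Sum>A\<in>S. c A / (t + e) * indicator A x) \<le> 1" for x
      using bound[of x] te \<open>0 < e\<close>
      by (simp add: sum_divide_distrib[symmetric] divide_simps)
  qed (use nonneg te in auto)
  then show "(\<Sum>A\<in>S. c A * w A) \<le> t + e"
    using te by (simp add: sum_divide_distrib[symmetric] divide_simps)
qed

lemma balanced_game_le_1: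
  assumes "balanced_game w"
  shows "w A \<le> 1"
  using balanced_game_sum_le[OF assms, of "{A}" "\<lambda>_. 1" 1] by (simp add: indicator_le_1)

lemma balanced_game_empty:
  assumes "balanced_game w"
  shows "w {} \<le> 0"
  using balanced_game_sum_le[OF assms, of "{{}}" "\<lambda>_. 1" 0] by simp

lemma balanced_game_compl_le:
  fixes w :: "'a set \<Rightarrow> real"
  assumes "balanced_game w"
  shows "w A + w (- A) \<le> 1"
proof -
  have "A \<noteq> - A" by blast
  then show ?thesis
    using balanced_game_sum_le[OF assms, of "{A, - A}" "\<lambda>_. 1" 1]
    by (simp split: split_indicator)
qed

section \<open>Raising a balanced set function at a set or at its complement\<close>

lemma sum_fun_upd_add:
  fixes c w :: "'b \<Rightarrow> real"
  assumes "finite S" "A \<in> S"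
  shows "(\<Sum>B\<in>S. c B * (w(A := w A + e)) B) = (\<Sum>B\<in>S. c B * w B) + c A * e"
  using assms by (simp add: sum.remove[of S A] algebra_simps)

text \<open>If both raises fail, each has a witnessing family that exceeds \<open>1\<close> only
  through the weight, \<open>p\<close> or \<open>q\<close>, of the raised set. Scaling each family
  by the weight from the other gives \<open>A\<close> and \<open>- A\<close> the common weight
  \<open>p * q\<close>; cancelling it lowers the pointwise bound by \<open>p * q\<close>, but the
  weighted sum of \<open>w\<close> by only \<open>p * q * (w A + w (- A))\<close>.\<close>

lemma balanced_game_raise:
  fixes w :: "'a set \<Rightarrow> real"
  assumes bal: "balanced_game w" and gap: "w A + w (- A) + 2 * e \<le> 1"
  shows "balanced_game (w(A := w A + e)) \<or> balanced_game (w(- A := w (- A) + e))"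
proof (rule ccontr)
  have violation: "\<exists>S c. finite S \<and> A \<in> S \<and> - A \<in> S \<and> (\<forall>B. 0 \<le> c B) \<and>
       (\<forall>x. (\<Sum>B\<in>S. c B * indicator B x) \<le> 1) \<and> 1 < (\<Sum>B\<in>S. c B * w B) + c D * e"
    if not_bal: "\<not> balanced_game (w(D := w D + e))" and D: "D = A \<or> D = - A" for D
  proof -
    obtain S c where S: "finite S" "\<And>B. B \<in> S \<Longrightarrow> 0 \<le> c B"
      "\<And>x. (\<Sum>B\<in>S. c B * indicator B x) \<le> 1" "1 < (\<Sum>B\<in>S. c B * (w(D := w D + e)) B)"
      using not_bal unfolding balanced_game_def by (auto simp: not_le)
    \<comment> \<open>Padding with zero weights puts both \<open>A\<close> and \<open>- A\<close>
      into the index set, whether or not the violating family contained them.\<close>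
    define T where "T = insert A (insert (- A) S)"
    define d where "d B = (if B \<in> S then c B else 0)" for B
    have T: "finite T" "S \<subseteq> T" "D \<in> T" using S(1) D by (auto simp: T_def)
    have eq: "(\<Sum>B\<in>T. d B * f B) = (\<Sum>B\<in>S. c B * f B)" for f :: "'a set \<Rightarrow> real"
      using T by (intro sum.mono_neutral_cong_right) (auto simp: d_def)
    have "1 < (\<Sum>B\<in>T. d B * w B) + d D * e"
      using S(4) eq[of "w(D := w D + e)"] sum_fun_upd_add[OF T(1,3), of d w e] by simp
    moreover have "\<forall>B. 0 \<le> d B" using S(2) by (simp add: d_def)
    moreover have "\<forall>x. (\<Sum>B\<in>T. d B * indicator B x) \<le> 1" using S(3) by (simp add: eq)
    ultimately show ?thesis using T(1) unfolding T_def by blast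
  qed
  assume neg: "\<not> ?thesis"
  obtain S1 c1 where 1: "finite S1" "A \<in> S1" "- A \<in> S1" "\<And>B. 0 \<le> c1 B"
    "\<And>x. (\<Sum>B\<in>S1. c1 B * indicator B x) \<le> 1" "1 < (\<Sum>B\<in>S1. c1 B * w B) + c1 A * e"
    using violation[of A] neg by meson
  obtain S2 c2 where 2: "finite S2" "A \<in> S2" "- A \<in> S2" "\<And>B. 0 \<le> c2 B"
    "\<And>x. (\<Sum>B\<in>S2. c2 B * indicator B x) \<le> 1" "1 < (\<Sum>B\<in>S2. c2 B * w B) + c2 (- A) * e"
    using violation[of "- A"] neg by meson
  define p q where "p = c1 A" and "q = c2 (- A)"
  \<comment> \<open>If the raised set had weight zero, the family would already violate balancedness
    of \<open>w\<close>.\<close>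
  have pq: "0 < p" "0 < q"
  proof -
    have "(\<Sum>B\<in>S1. c1 B * w B) \<le> 1" "(\<Sum>B\<in>S2. c2 B * w B) \<le> 1"
      using balanced_game_sum_le[OF bal 1(1) _ 1(5)] balanced_game_sum_le[OF bal 2(1) _ 2(5)] 1(4) 2(4)
      by auto
    then have "p \<noteq> 0" "q \<noteq> 0" using 1(6) 2(6) by (auto simp: p_def q_def)
    then show "0 < p" "0 < q" using 1(4)[of A] 2(4)[of "- A"] by (auto simp: p_def q_def)
  qed
  define T where "T = S1 \<union> S2"
  define d1 where "d1 B = (if B \<in> S1 then c1 B else 0)" for B
  define d2 where "d2 B = (if B \<in> S2 then c2 B else 0)" for B
  \<comment> \<open>In \<open>q c\<^sub>1 + p c\<^sub>2\<close> both \<open>A\<close> and \<open>- A\<close> have weight at least \<open>p q\<close>, and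
    \<open>\<chi>\<^sub>A + \<chi>\<^sub>-\<^sub>A = 1\<close> allows us to cancel it.\<close>
  define d where "d B = q * d1 B + p * d2 B - p * q * (if B = A \<or> B = - A then 1 else 0)" for B
  have "A \<noteq> - A" by blast
  have T: "finite T" "A \<in> T" "- A \<in> T" using 1 2 by (auto simp: T_def)
  have sum_d: "(\<Sum>B\<in>T. d B * f B) =
      q * (\<Sum>B\<in>S1. c1 B * f B) + p * (\<Sum>B\<in>S2. c2 B * f B) - p * q * (f A + f (- A))"
    for f :: "'a set \<Rightarrow> real"
  proof -
    have e1: "(\<Sum>B\<in>T. d1 B * f B) = (\<Sum>B\<in>S1. c1 B * f B)"
      using T by (intro sum.mono_neutral_cong_right) (auto simp: d1_def T_def)
    have e2: "(\<Sum>B\<in>T. d2 B * f B) = (\<Sum>B\<in>S2. c2 B * f B)"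
      using T by (intro sum.mono_neutral_cong_right) (auto simp: d2_def T_def)
    have e3: "(\<Sum>B\<in>T. (if B = A \<or> B = - A then 1 else 0) * f B) = f A + f (- A)"
    proof -
      have "(\<Sum>B\<in>T. (if B = A \<or> B = - A then 1 else 0) * f B) = sum f {A, - A}"
        using T by (intro sum.mono_neutral_cong_right) auto
      then show ?thesis using \<open>A \<noteq> - A\<close> by simp
    qed
    show ?thesis
      unfolding e1[symmetric] e2[symmetric] e3[symmetric] d_def
      by (simp only: sum_distrib_left sum.distrib[symmetric] sum_subtractf[symmetric])
         (rule sum.cong, auto simp: algebra_simps)
  qed
  have "(\<Sum>B\<in>T. d B * w B) \<le> q + p - p * q"
  proof (rule balanced_game_sum_le[OF bal T(1)])
    fix B
    have "0 \<le> d1 B" "0 \<le> d2 B" using 1(4) 2(4) by (auto simp: d1_def d2_def)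
    \<comment> \<open>At \<open>A\<close> the term \<open>q * c1 A\<close> cancels against
      \<open>p * q\<close> and leaves \<open>p * d2 A\<close>; at \<open>- A\<close> the term
      \<open>p * c2 (- A)\<close> cancels and leaves \<open>q * d1 (- A)\<close>.\<close>
    then show "0 \<le> d B"
      using pq 1(2) 2(3) \<open>A \<noteq> - A\<close>
      by (auto simp: d_def d1_def d2_def p_def q_def algebra_simps)
  next
    fix x
    have "q * (\<Sum>B\<in>S1. c1 B * indicator B x) \<le> q * 1" "p * (\<Sum>B\<in>S2. c2 B * indicator B x) \<le> p * 1"
      using pq 1(5) 2(5) by (auto intro: mult_left_mono)
    moreover have "indicator A x + indicator (- A) x = (1 :: real)" by (simp add: indicator_def)
    ultimately show "(\<Sum>B\<in>T. d B * indicator B x) \<le> q + p - p * q"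
      unfolding sum_d by simp
  qed
  \<comment> \<open>Together these strict bounds put the sum above
    \<open>q + p - p * q * (w A + w (- A) + 2 * e)\<close>, which by \<open>gap\<close> is at least
    \<open>q + p - p * q\<close>.\<close>
  moreover have "q * (1 - p * e) < q * (\<Sum>B\<in>S1. c1 B * w B)" "p * (1 - q * e) < p * (\<Sum>B\<in>S2. c2 B * w B)"
    using 1(6) 2(6) unfolding p_def[symmetric] q_def[symmetric]
    by (intro mult_strict_left_mono pq, linarith)+
  moreover have "p * q * (w A + w (- A) + 2 * e) \<le> p * q * 1"
    using pq gap by (intro mult_left_mono) auto
  ultimately show False
    unfolding sum_d by (simp add: algebra_simps)
qed

text \<open>The partition \<open>A\<close>, \<open>B\<close>, \<open>- (A \<union> B)\<close> covers
  each point once, which gives \<open>w A + w B \<le> w (A \<union> B)\<close>. The three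
  complements cover each point twice, which gives the reverse inequality. Empty sets are treated
  apart because members of these families could then coincide.\<close>

lemma balanced_game_additive:
  fixes w :: "'a set \<Rightarrow> real"
  assumes bal: "balanced_game w" and compl: "\<And>A. w A + w (- A) = 1" and disjoint: "A \<inter> B = {}"
  shows "w (A \<union> B) = w A + w B"
proof (cases "A = {} \<or> B = {}")
  case True
  have "w UNIV \<le> 1" "w {} \<le> 0"
    using bal by (simp_all add: balanced_game_le_1 balanced_game_empty)
  then have "w {} = 0" using compl[of "{}"] by simp
  with True show ?thesis by auto
next
  case False
  have distinct: "A \<noteq> B" "A \<noteq> - (A \<union> B)" "B \<noteq> - (A \<union> B)"
    "- A \<noteq> - B" "- A \<noteq> A \<union> B" "- B \<noteq> A \<union> B"
    using False disjoint by blast+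
  have "(\<Sum>D\<in>{A, B, - (A \<union> B)}. 1 * w D) \<le> 1"
  proof (rule balanced_game_sum_le[OF bal])
    show "(\<Sum>D\<in>{A, B, - (A \<union> B)}. 1 * indicator D x) \<le> (1 :: real)" for x
      using disjoint distinct by (auto split: split_indicator)
  qed auto
  moreover have "(\<Sum>D\<in>{- A, - B, A \<union> B}. 1 * w D) \<le> 2"
  proof (rule balanced_game_sum_le[OF bal])
    show "(\<Sum>D\<in>{- A, - B, A \<union> B}. 1 * indicator D x) \<le> (2 :: real)" for x
      using disjoint distinct by (auto split: split_indicator)
  qed auto
  moreover have "(\<Sum>D\<in>{A, B, - (A \<union> B)}. 1 * w D) = w A + w B + w (- (A \<union> B))"
    "(\<Sum>D\<in>{- A, - B, A \<union> B}. 1 * w D) = w (- A) + w (- B) + w (A \<union> B)"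
    using distinct by (simp_all add: add.assoc)
  ultimately show ?thesis
    using compl[of A] compl[of B] compl[of "A \<union> B"] by linarith
qed

section \<open>Maximal balanced set functions by Zorn's lemma\<close>

lemma balanced_game_chain_Sup:
  fixes C :: "('a set \<Rightarrow> real) set"
  assumes "C \<noteq> {}" and bal: "\<And>w. w \<in> C \<Longrightarrow> balanced_game w"
    and chain: "\<And>v w. v \<in> C \<Longrightarrow> w \<in> C \<Longrightarrow> v \<le> w \<or> w \<le> v"
  shows "balanced_game (\<lambda>A. SUP w\<in>C. w A)"
  unfolding balanced_game_def
proof (intro allI impI)
  fix S :: "'a set set" and c :: "'a set \<Rightarrow> real"
  assume S: "finite S" "\<forall>A\<in>S. 0 \<le> c A" "\<forall>x. (\<Sum>A\<in>S. c A * indicator A x) \<le> 1"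
  let ?s = "\<lambda>A. SUP w\<in>C. w A"
  have bdd: "bdd_above ((\<lambda>w. w A) ` C)" for A
    using bal by (auto intro!: bdd_aboveI2[of _ _ 1] balanced_game_le_1)
  \<comment> \<open>Balancedness concerns finitely many sets at a time, and on finitely many sets
    one member of the chain comes close to all the suprema simultaneously.\<close>
  have approx: "\<exists>w\<in>C. \<forall>A\<in>S. ?s A - e \<le> w A" if "0 < e" for e
    using S(1)
  proof induction
    case empty
    then show ?case using \<open>C \<noteq> {}\<close> by auto
  next
    case (insert A S)
    then obtain w where w: "w \<in> C" "\<forall>A\<in>S. ?s A - e \<le> w A" by blast
    obtain v where v: "v \<in> C" "?s A - e < v A"
      using less_cSUP_iff[OF \<open>C \<noteq> {}\<close> bdd, of "?s A - e" A] \<open>0 < e\<close> by auto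
    from chain[OF v(1) w(1)] show ?case
    proof
      assume "v \<le> w"
      then show ?thesis using v w by (intro bexI[of _ w]) (auto simp: le_fun_def intro: order_trans less_imp_le)
    next
      assume "w \<le> v"
      then show ?thesis using v w by (intro bexI[of _ v]) (auto simp: le_fun_def intro: order_trans less_imp_le)
    qed
  qed
  show "(\<Sum>A\<in>S. c A * ?s A) \<le> 1"
  proof (rule field_le_epsilon)
    fix e :: real assume "0 < e"
    \<comment> \<open>An error of \<open>e / K\<close> at each set costs at most \<open>e\<close> in
      the weighted sum; the summand \<open>1\<close> keeps \<open>K\<close> positive when all
      weights vanish.\<close>
    define K where "K = 1 + (\<Sum>A\<in>S. c A)"
    have K: "0 < K" "(\<Sum>A\<in>S. c A) \<le> K" using sum_nonneg[of S c] S(2) by (auto simp: K_def)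
    obtain w where w: "w \<in> C" "\<forall>A\<in>S. ?s A - e / K \<le> w A"
      using approx[of "e / K"] K \<open>0 < e\<close> by auto
    have "(\<Sum>A\<in>S. c A * ?s A) \<le> (\<Sum>A\<in>S. c A * (w A + e / K))"
      using w S(2) by (intro sum_mono mult_left_mono) (auto simp: algebra_simps)
    also have "\<dots> = (\<Sum>A\<in>S. c A * w A) + (\<Sum>A\<in>S. c A) * (e / K)"
      by (simp only: distrib_left sum.distrib sum_distrib_right)
    also have "\<dots> \<le> 1 + K * (e / K)"
      using balanced_game_sum_le[OF bal[OF w(1)] S(1)] S K \<open>0 < e\<close>
      by (intro add_mono mult_right_mono) auto
    finally show "(\<Sum>A\<in>S. c A * ?s A) \<le> 1 + e" using K by simp
  qed
qed

lemma balanced_game_dominated_by_charge: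
  fixes w :: "'a set \<Rightarrow> real"
  assumes "balanced_game w"
  obtains m where "\<And>A. w A \<le> m A" "m UNIV = 1"
    "\<And>A B. A \<inter> B = {} \<Longrightarrow> m (A \<union> B) = m A + m B"
proof -
  define P where "P = {v. balanced_game v \<and> w \<le> v}"
  have "\<exists>m\<in>P. \<forall>v\<in>P. m \<le> v \<longrightarrow> v = m"
  proof (rule predicate_Zorn)
    show "partial_order_on P (relation_of (\<le>) P)"
      by (rule partial_order_on_relation_ofI) auto
    fix C assume C: "C \<in> Chains (relation_of (\<le>) P)"
    then have "C \<subseteq> P" and chain: "\<And>u v. u \<in> C \<Longrightarrow> v \<in> C \<Longrightarrow> u \<le> v \<or> v \<le> u"
      by (auto simp: Chains_def relation_of_def)
    show "\<exists>u\<in>P. \<forall>v\<in>C. v \<le> u"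
    proof (cases "C = {}")
      case True
      then show ?thesis using assms by (auto simp: P_def)
    next
      case False
      have bal: "v \<in> C \<Longrightarrow> balanced_game v" for v using \<open>C \<subseteq> P\<close> by (auto simp: P_def)
      have ub: "v \<in> C \<Longrightarrow> v \<le> (\<lambda>A. SUP v\<in>C. v A)" for v
        using bal by (auto simp: le_fun_def intro!: cSUP_upper bdd_aboveI2[of _ _ 1] balanced_game_le_1)
      obtain v where "v \<in> C" using False by blast
      then have "w \<le> (\<lambda>A. SUP v\<in>C. v A)" using ub[of v] \<open>C \<subseteq> P\<close> by (auto simp: P_def)
      then show ?thesis
        using balanced_game_chain_Sup[OF False bal chain] ub
        by (intro bexI[of _ "\<lambda>A. SUP v\<in>C. v A"]) (auto simp: P_def)
    qed
  qed
  then obtain m where m: "balanced_game m" "w \<le> m"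
    and max: "\<And>v. balanced_game v \<Longrightarrow> m \<le> v \<Longrightarrow> v = m"
    unfolding P_def by (blast intro: order_trans)
  have compl: "m A + m (- A) = 1" for A
  proof (rule ccontr)
    assume "m A + m (- A) \<noteq> 1"
    then have less: "m A + m (- A) < 1" using balanced_game_compl_le[OF m(1), of A] by simp
    \<comment> \<open>Half of the gap, so that \<open>balanced_game_raise\<close> applies with
      equality; either raise would contradict maximality.\<close>
    define e where "e = (1 - (m A + m (- A))) / 2"
    have "0 < e" "m A + m (- A) + 2 * e \<le> 1" using less by (simp_all add: e_def field_simps)
    moreover have "\<not> balanced_game (m(D := m D + e))" for D
    proof
      assume "balanced_game (m(D := m D + e))"
      then have "m(D := m D + e) = m" using \<open>0 < e\<close> by (intro max) (auto simp: le_fun_def)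
      then have "m D + e = m D" by (metis fun_upd_same)
      then show False using \<open>0 < e\<close> by simp
    qed
    ultimately show False using balanced_game_raise[OF m(1)] by blast
  qed
  have add: "m (A \<union> B) = m A + m B" if "A \<inter> B = {}" for A B
    using balanced_game_additive[OF m(1) compl that] .
  have "m UNIV = 1"
    using compl[of "{}"] add[of "{}" "{}"] by simp
  then show thesis
    using m(2) add by (intro that[of m]) (simp_all add: le_fun_def)
qed


section \<open>A regular Borel measure above a finitely additive one\<close>

lemma compact_t2_normal:
  fixes K L :: "'a::t2_space set"
  assumes "compact (UNIV :: 'a set)" "closed K" "closed L" "K \<inter> L = {}"
  obtains U V where "open U" "open V" "K \<subseteq> U" "L \<subseteq> V" "U \<inter> V = {}"
proof -
  have "compact K" "compact L"
    using compact_Int_closed[OF assms(1)] assms(2,3) by force+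
  moreover have "Hausdorff_space (euclidean :: 'a topology)"
    by (simp add: Hausdorff_space_def disjnt_def) (meson hausdorff)
  ultimately show thesis
    using assms(4) that unfolding Hausdorff_space_compact_sets by (auto simp: disjnt_def) metis
qed

text \<open>The closed sets \<open>K - U\<close> and \<open>K - V\<close> are disjoint, hence have
  disjoint open neighbourhoods \<open>P\<close> and \<open>Q\<close>. Then \<open>K - P\<close> lies
  in \<open>U\<close>, \<open>K - Q\<close> lies in \<open>V\<close>, and they cover
  \<open>K\<close> because no point is in both \<open>P\<close> and \<open>Q\<close>.\<close>

lemma closed_subset_Un_split:
  fixes K :: "'a::t2_space set"
  assumes "compact (UNIV :: 'a set)" "closed K" "open U" "open V" "K \<subseteq> U \<union> V"
  obtains K1 K2 where "closed K1" "closed K2" "K1 \<subseteq> U" "K2 \<subseteq> V" "K = K1 \<union> K2"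
proof -
  obtain P Q where PQ: "open P" "open Q" "K - U \<subseteq> P" "K - V \<subseteq> Q" "P \<inter> Q = {}"
    using compact_t2_normal[OF assms(1), of "K - U" "K - V"] assms by blast
  show thesis
    by (rule that[of "K - P" "K - Q"]) (use PQ assms in auto)
qed

section \<open>The outer measure induced by a charge\<close>

locale charge_on_compactum =
  fixes m :: "'a::t2_space set \<Rightarrow> real"
  assumes compact_UNIV: "compact (UNIV :: 'a set)"
    and m_nonneg: "0 \<le> m A"
    and m_Un: "A \<inter> B = {} \<Longrightarrow> m (A \<union> B) = m A + m B"
    and m_UNIV: "m UNIV = 1"
begin

lemma m_empty: "m {} = 0"
  using m_Un[of "{}" "{}"] by simp

lemma m_mono: "A \<subseteq> B \<Longrightarrow> m A \<le> m B"
  using m_Un[of A "B - A"] m_nonneg[of "B - A"] by (simp add: Un_absorb1)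

lemma m_subadd: "m (A \<union> B) \<le> m A + m B"
  using m_Un[of A "B - A"] m_mono[of "B - A" B] by auto

text \<open>The classical passage from a content on compact sets to an outer measure; closed sets
  serve as the compact ones. This first stage is meant for open \<open>U\<close>. Values are in
  \<open>ennreal\<close> to suit Caratheodory's theorem.\<close>

definition inner_content :: "'a set \<Rightarrow> ennreal" where
  "inner_content U = (SUP K\<in>{K. closed K \<and> K \<subseteq> U}. ennreal (m K))"

definition outer_content :: "'a set \<Rightarrow> ennreal" where
  "outer_content A = (INF U\<in>{U. open U \<and> A \<subseteq> U}. inner_content U)"

lemma le_inner_content: "closed K \<Longrightarrow> K \<subseteq> U \<Longrightarrow> ennreal (m K) \<le> inner_content U"
  unfolding inner_content_def by (rule SUP_upper) simp

lemma inner_content_le: "(\<And>K. closed K \<Longrightarrow> K \<subseteq> U \<Longrightarrow> ennreal (m K) \<le> t) \<Longrightarrow> inner_content U \<le> t"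
  unfolding inner_content_def by (rule SUP_least) simp

lemma inner_content_mono: "U \<subseteq> V \<Longrightarrow> inner_content U \<le> inner_content V"
  by (intro inner_content_le le_inner_content) auto

lemma inner_content_empty: "inner_content {} = 0"
  using inner_content_le[of "{}" 0] by (auto simp: m_empty)

lemma inner_content_Un:
  assumes "open U" "open V"
  shows "inner_content (U \<union> V) \<le> inner_content U + inner_content V"
proof (rule inner_content_le)
  fix K assume "closed K" "K \<subseteq> U \<union> V"
  then obtain K1 K2 where K: "closed K1" "closed K2" "K1 \<subseteq> U" "K2 \<subseteq> V" "K = K1 \<union> K2"
    using closed_subset_Un_split[OF compact_UNIV _ assms] by metis
  have "ennreal (m K) \<le> ennreal (m K1 + m K2)"
    using K(5) m_subadd by (simp add: ennreal_leI)
  also have "\<dots> = ennreal (m K1) + ennreal (m K2)"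
    using m_nonneg by simp
  also have "\<dots> \<le> inner_content U + inner_content V"
    using K by (intro add_mono le_inner_content)
  finally show "ennreal (m K) \<le> inner_content U + inner_content V" .
qed

lemma inner_content_UN_finite:
  assumes "finite I" "\<And>i. i \<in> I \<Longrightarrow> open (U i)"
  shows "inner_content (\<Union>i\<in>I. U i) \<le> (\<Sum>i\<in>I. inner_content (U i))"
  using assms
proof induction
  case (insert i I)
  have "inner_content (U i \<union> (\<Union>i\<in>I. U i)) \<le> inner_content (U i) + inner_content (\<Union>i\<in>I. U i)"
    using insert.prems by (intro inner_content_Un) auto
  also have "\<dots> \<le> inner_content (U i) + (\<Sum>i\<in>I. inner_content (U i))"
    using insert by (intro add_left_mono) auto
  finally show ?case using insert.hyps by simp
qed (simp add: inner_content_empty)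

text \<open>Compactness is what turns finite into countable subadditivity: a closed \<open>K\<close>
  inside the union is already covered by finitely many \<open>U i\<close>.\<close>

lemma inner_content_UN:
  fixes U :: "nat \<Rightarrow> 'a set"
  assumes "\<And>i. open (U i)"
  shows "inner_content (\<Union>i. U i) \<le> (\<Sum>i. inner_content (U i))"
proof (rule inner_content_le)
  fix K assume K: "closed K" "K \<subseteq> (\<Union>i. U i)"
  then have "compact K"
    using compact_Int_closed[OF compact_UNIV] by force
  then obtain I where I: "finite I" "K \<subseteq> (\<Union>i\<in>I. U i)"
    by (rule compactE_image[where f = U and C = UNIV]) (use assms K in auto)
  have "ennreal (m K) \<le> inner_content (\<Union>i\<in>I. U i)"
    using K I by (intro le_inner_content)
  also have "\<dots> \<le> (\<Sum>i\<in>I. inner_content (U i))"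
    using I assms by (intro inner_content_UN_finite)
  also have "\<dots> \<le> (\<Sum>i. inner_content (U i))"
    using I by (intro sum_le_suminf) auto
  finally show "ennreal (m K) \<le> (\<Sum>i. inner_content (U i))" .
qed

lemma outer_content_le: "open U \<Longrightarrow> A \<subseteq> U \<Longrightarrow> outer_content A \<le> inner_content U"
  unfolding outer_content_def by (rule INF_lower) simp

lemma le_outer_content: "(\<And>U. open U \<Longrightarrow> A \<subseteq> U \<Longrightarrow> t \<le> inner_content U) \<Longrightarrow> t \<le> outer_content A"
  unfolding outer_content_def by (rule INF_greatest) simp

lemma outer_content_mono: "A \<subseteq> B \<Longrightarrow> outer_content A \<le> outer_content B"
  by (intro le_outer_content outer_content_le) auto

lemma outer_content_open: "open U \<Longrightarrow> outer_content U = inner_content U"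
  by (intro antisym outer_content_le le_outer_content inner_content_mono) auto

text \<open>\<open>K\<close> itself competes in the supremum for every open superset, so domination
  of the capacity survives the passage to the outer measure.\<close>

lemma outer_content_closed: "closed K \<Longrightarrow> ennreal (m K) \<le> outer_content K"
  by (intro le_outer_content le_inner_content)

lemma outer_content_UNIV: "outer_content UNIV = 1"
proof (rule antisym)
  have "m K \<le> 1" for K using m_mono[of K UNIV] m_UNIV by simp
  then show "outer_content UNIV \<le> 1" unfolding outer_content_open[OF open_UNIV] by (intro inner_content_le) simp
  show "1 \<le> outer_content UNIV" using outer_content_closed[of UNIV] m_UNIV by simp
qed

lemma outer_content_approx:
  assumes "0 < e"
  obtains U where "open U" "A \<subseteq> U" "inner_content U \<le> outer_content A + ennreal e"
proof -
  \<comment> \<open>Finiteness is needed for adding \<open>e\<close> to give a strictly larger value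
    in \<open>ennreal\<close>.\<close>
  have "outer_content A \<le> 1" using outer_content_mono[of A UNIV] outer_content_UNIV by simp
  then have "outer_content A < outer_content A + ennreal e"
    using assms by (cases "outer_content A") (auto simp: ennreal_less_iff top_unique simp flip: ennreal_plus)
  then show thesis
    using that unfolding outer_content_def by (auto simp: INF_less_iff intro: less_imp_le)
qed

lemma outer_content_UN:
  fixes A :: "nat \<Rightarrow> 'a set"
  shows "outer_content (\<Union>i. A i) \<le> (\<Sum>i. outer_content (A i))"
proof (rule ennreal_le_epsilon)
  fix e :: real assume "0 < e"
  then have "\<exists>U. open U \<and> A i \<subseteq> U \<and> inner_content U \<le> outer_content (A i) + ennreal (e * (1/2) ^ Suc i)" for i
    by (rule_tac outer_content_approx[of "e * (1/2) ^ Suc i" "A i"]) auto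
  then obtain U where U: "\<And>i. open (U i)" "\<And>i. A i \<subseteq> U i"
    "\<And>i. inner_content (U i) \<le> outer_content (A i) + ennreal (e * (1/2) ^ Suc i)"
    by metis
  have "outer_content (\<Union>i. A i) \<le> inner_content (\<Union>i. U i)"
    using U by (intro outer_content_le) blast+
  also have "\<dots> \<le> (\<Sum>i. inner_content (U i))"
    by (intro inner_content_UN U)
  also have "\<dots> \<le> (\<Sum>i. outer_content (A i) + ennreal (e * (1/2) ^ Suc i))"
    using U(3) by (intro suminf_le) auto
  also have "\<dots> = (\<Sum>i. outer_content (A i)) + (\<Sum>i. ennreal (e * (1/2) ^ Suc i))"
    by (intro suminf_add[symmetric]) auto
  also have "(\<Sum>i. ennreal (e * (1/2) ^ Suc i)) = ennreal e"
    using sums_mult[OF power_half_series, of e] \<open>0 < e\<close>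
    by (intro suminf_ennreal_eq) auto
  finally show "outer_content (\<Union>i. A i) \<le> (\<Sum>i. outer_content (A i)) + ennreal e" .
qed

section \<open>Caratheodory measurability of open sets\<close>

lemma outer_measure: "outer_measure_space (Pow UNIV) outer_content"
proof -
  have "outer_content {} = 0" by (simp add: outer_content_open inner_content_empty)
  then show ?thesis
    by (auto simp: outer_measure_space_def positive_def increasing_def countably_subadditive_def
        intro: outer_content_mono outer_content_UN)
qed

text \<open>The Caratheodory inequality for open test sets. For closed
  \<open>K \<subseteq> U \<inter> W\<close> the open set \<open>W - K\<close> contains
  \<open>W - U\<close>, and each closed \<open>L \<subseteq> W - K\<close> is disjoint from
  \<open>K\<close>, so \<open>m K + m L = m (K \<union> L)\<close> is at most
  \<open>inner_content W\<close>. Suprema over \<open>L\<close> and then \<open>K\<close> finish the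
  argument.\<close>

lemma inner_content_split:
  assumes "open U" "open W"
  shows "inner_content (U \<inter> W) + outer_content (W - U) \<le> inner_content W"
proof -
  have "ennreal (m K) + outer_content (W - U) \<le> inner_content W" if K: "closed K" "K \<subseteq> U \<inter> W" for K
  proof -
    have "ennreal (m K) + outer_content (W - U) \<le> ennreal (m K) + inner_content (W - K)"
      using K assms by (intro add_left_mono outer_content_le) auto
    also have "\<dots> = (SUP L\<in>{L. closed L \<and> L \<subseteq> W - K}. ennreal (m K) + ennreal (m L))"
      unfolding inner_content_def by (rule ennreal_SUP_add_right) auto
    also have "\<dots> \<le> inner_content W"
    proof (rule SUP_least)
      fix L assume "L \<in> {L. closed L \<and> L \<subseteq> W - K}"
      then have L: "closed L" "L \<subseteq> W - K" by auto
      then have "m (K \<union> L) = m K + m L" by (intro m_Un) auto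
      then have "ennreal (m K) + ennreal (m L) = ennreal (m (K \<union> L))"
        using m_nonneg by simp
      also have "\<dots> \<le> inner_content W" using K L by (intro le_inner_content) auto
      finally show "ennreal (m K) + ennreal (m L) \<le> inner_content W" .
    qed
    finally show ?thesis .
  qed
  then have "(SUP K\<in>{K. closed K \<and> K \<subseteq> U \<inter> W}. ennreal (m K) + outer_content (W - U)) \<le> inner_content W"
    by (intro SUP_least) auto
  moreover have "(SUP K\<in>{K. closed K \<and> K \<subseteq> U \<inter> W}. ennreal (m K) + outer_content (W - U)) =
      inner_content (U \<inter> W) + outer_content (W - U)"
    unfolding inner_content_def by (intro ennreal_SUP_add_left) auto
  ultimately show ?thesis by simp
qed

text \<open>An arbitrary test set \<open>A\<close> is replaced by an open \<open>W\<close>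
  containing it, where \<open>inner_content_split\<close> applies; the other inequality is
  subadditivity.\<close>

lemma open_in_lambda_system:
  assumes "open U"
  shows "U \<in> lambda_system UNIV (Pow UNIV) outer_content"
proof -
  have "outer_content (U \<inter> A) + outer_content ((UNIV - U) \<inter> A) = outer_content A" for A
  proof (rule antisym)
    show "outer_content (U \<inter> A) + outer_content ((UNIV - U) \<inter> A) \<le> outer_content A"
    proof (rule le_outer_content)
      fix W assume W: "open W" "A \<subseteq> W"
      have "outer_content (U \<inter> A) + outer_content ((UNIV - U) \<inter> A) \<le> inner_content (U \<inter> W) + outer_content (W - U)"
        using W assms by (intro add_mono outer_content_le outer_content_mono) auto
      also have "\<dots> \<le> inner_content W" using W assms by (intro inner_content_split)
      finally show "outer_content (U \<inter> A) + outer_content ((UNIV - U) \<inter> A) \<le> inner_content W" .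
    qed
    have "subadditive (Pow UNIV) outer_content"
      using outer_measure ring_of_sets.countably_subadditive_subadditive
        sigma_algebra_Pow[THEN sigma_algebra.axioms(1), THEN algebra.axioms(1)]
      unfolding outer_measure_space_def by blast
    then have "outer_content ((U \<inter> A) \<union> ((UNIV - U) \<inter> A)) \<le> outer_content (U \<inter> A) + outer_content ((UNIV - U) \<inter> A)"
      by (rule subadditiveD) auto
    moreover have "(U \<inter> A) \<union> ((UNIV - U) \<inter> A) = A" by blast
    ultimately show "outer_content A \<le> outer_content (U \<inter> A) + outer_content ((UNIV - U) \<inter> A)" by simp
  qed
  then show ?thesis by (simp add: lambda_system_def)
qed

definition radon :: "'a measure" where
  "radon = measure_of UNIV (sets borel) outer_content"

lemma sets_radon [simp]: "sets radon = sets borel" and space_radon [simp]: "space radon = UNIV"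
  by (simp_all add: radon_def sets.sigma_sets_eq[of borel, simplified])

text \<open>\<open>measure_of\<close> takes the prescribed values only once they are known to form a
  measure. This holds since the Caratheodory-measurable sets are a sigma-algebra containing the open
  sets, hence all Borel sets.\<close>

lemma emeasure_radon:
  assumes "B \<in> sets borel"
  shows "emeasure radon B = outer_content B"
proof -
  let ?L = "lambda_system UNIV (Pow UNIV) outer_content"
  have ms: "measure_space UNIV ?L outer_content"
    by (rule sigma_algebra.caratheodory_lemma[OF sigma_algebra_Pow outer_measure])
  then interpret L: sigma_algebra UNIV ?L by (simp add: measure_space_def)
  have "sets borel \<subseteq> ?L"
    using L.sigma_sets_subset[of "Collect open"] open_in_lambda_system
    by (simp add: borel_def image_subset_iff subset_iff)
  moreover have "positive ?L outer_content" "countably_additive ?L outer_content"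
    using ms by (simp_all add: measure_space_def)
  ultimately have "positive (sets borel) outer_content" "countably_additive (sets borel) outer_content"
    unfolding positive_def countably_additive_def by blast+
  then show ?thesis
    unfolding radon_def using assms sets.sigma_algebra_axioms[of borel]
    by (intro emeasure_measure_of_sigma) auto
qed

lemma prob_space_radon: "prob_space radon"
  by (rule prob_spaceI) (simp add: emeasure_radon outer_content_UNIV)

section \<open>Regularity and domination\<close>

lemma outer_regular_radon:
  assumes "B \<in> sets borel"
  shows "emeasure radon B = (INF U\<in>{U. B \<subseteq> U \<and> open U}. emeasure radon U)"
proof -
  have "emeasure radon B = (INF U\<in>{U. open U \<and> B \<subseteq> U}. inner_content U)"
    using assms by (simp add: emeasure_radon outer_content_def)
  also have "\<dots> = (INF U\<in>{U. B \<subseteq> U \<and> open U}. emeasure radon U)"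
    by (intro INF_cong) (auto simp: emeasure_radon outer_content_open)
  finally show ?thesis .
qed

lemma regular_radon: "regular_borel_measure radon"
  unfolding regular_borel_measure_def
proof (intro conjI ballI)
  interpret prob_space radon by (rule prob_space_radon)
  fix B :: "'a set" assume B: "B \<in> sets borel"
  show "emeasure radon B = (INF U\<in>{U. B \<subseteq> U \<and> open U}. emeasure radon U)"
    using B by (rule outer_regular_radon)
  show "emeasure radon B = (SUP K\<in>{K. K \<subseteq> B \<and> compact K}. emeasure radon K)"
  proof (rule antisym)
    show "(SUP K\<in>{K. K \<subseteq> B \<and> compact K}. emeasure radon K) \<le> emeasure radon B"
      using B by (intro SUP_least emeasure_mono) auto
    show "emeasure radon B \<le> (SUP K\<in>{K. K \<subseteq> B \<and> compact K}. emeasure radon K)"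
    proof (rule ennreal_le_epsilon)
      fix e :: real assume "0 < e"
      \<comment> \<open>Inner regularity at \<open>B\<close> comes from outer regularity at
        \<open>- B\<close>: the complement of \<open>U\<close> is a compact subset of
        \<open>B\<close>, and total mass \<open>1\<close> turns the excess of \<open>U\<close> over
        \<open>- B\<close> into the deficit of \<open>- U\<close> in \<open>B\<close>.\<close>
      obtain U where U: "open U" "- B \<subseteq> U" "inner_content U \<le> outer_content (- B) + ennreal e"
        using outer_content_approx[OF \<open>0 < e\<close>] .
      have "emeasure radon U \<le> emeasure radon (- B) + ennreal e"
        using U B by (simp add: emeasure_radon outer_content_open)
      then have "prob U \<le> prob (- B) + e"
        using \<open>0 < e\<close> by (simp add: emeasure_eq_measure flip: ennreal_plus)
      moreover have "prob (- B) = 1 - prob B" "prob (- U) = 1 - prob U"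
        using prob_compl[of B] prob_compl[of U] B U by (simp_all add: Compl_eq_Diff_UNIV)
      ultimately have "prob B \<le> prob (- U) + e" by simp
      then have "emeasure radon B \<le> emeasure radon (- U) + ennreal e"
        using \<open>0 < e\<close> by (simp add: emeasure_eq_measure flip: ennreal_plus)
      moreover have "compact (- U)"
        using compact_Int_closed[OF compact_UNIV, of "- U"] U by auto
      then have "emeasure radon (- U) \<le> (SUP K\<in>{K. K \<subseteq> B \<and> compact K}. emeasure radon K)"
        using U by (intro SUP_upper) auto
      ultimately show "emeasure radon B \<le> (SUP K\<in>{K. K \<subseteq> B \<and> compact K}. emeasure radon K) + ennreal e"
        by (meson add_right_mono order_trans)
    qed
  qed
qed simp

lemma le_measure_radon:
  assumes "closed K"
  shows "m K \<le> measure radon K"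
proof -
  interpret prob_space radon by (rule prob_space_radon)
  have "ennreal (m K) \<le> emeasure radon K"
    using assms by (simp add: emeasure_radon outer_content_closed)
  then show ?thesis by (simp add: emeasure_eq_measure)
qed

end


section \<open>The core of a balanced capacity\<close>

text \<open>Sets that are not closed contribute \<open>0\<close> to the weighted sum, and dropping
  them can only lower the sum of indicators. The closed ones are enumerated by
  \<open>{1..card T}\<close> to match the indexing in \<open>balanced\<close>.\<close>

lemma balanced_game_extension:
  fixes \<nu> :: "'a::t2_space set \<Rightarrow> real"
  assumes "balanced \<nu>"
  shows "balanced_game (\<lambda>A. if closed A then \<nu> A else 0)"
  unfolding balanced_game_def
proof (intro allI impI)
  fix S :: "'a set set" and c :: "'a set \<Rightarrow> real"
  assume S: "finite S" "\<forall>A\<in>S. 0 \<le> c A" "\<forall>x. (\<Sum>A\<in>S. c A * indicator A x) \<le> 1"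
  define T where "T = {A \<in> S. closed A}"
  have T: "finite T" "T \<subseteq> S" using S by (auto simp: T_def)
  obtain f where f: "bij_betw f {1..card T} T"
    using ex_bij_betw_nat_finite_1[OF T(1)] by blast
  have sum_T: "(\<Sum>i=1..card T. c (f i) * g (f i)) = (\<Sum>A\<in>T. c A * g A)" for g :: "'a set \<Rightarrow> real"
    by (rule sum.reindex_bij_betw[OF f])
  have "(\<Sum>i=1..card T. c (f i) * indicator (f i) x) \<le> 1" for x
    unfolding sum_T[of "\<lambda>A. indicator A x"]
    using order_trans[OF sum_mono2[OF S(1) T(2)] S(3)[rule_format, of x]] S(2) by simp
  moreover have "\<forall>i\<in>{1..card T}. 0 \<le> c (f i) \<and> closed (f i)"
    using f S(2) unfolding bij_betw_def T_def by blast
  ultimately have "(\<Sum>i=1..card T. c (f i) * \<nu> (f i)) \<le> 1"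
    by (intro assms[unfolded balanced_def, rule_format]) blast+
  moreover have "(\<Sum>A\<in>S. c A * (if closed A then \<nu> A else 0)) =
      (\<Sum>i=1..card T. c (f i) * \<nu> (f i))"
    unfolding sum_T using T S(1) by (intro sum.mono_neutral_cong_right) (auto simp: T_def)
  ultimately show "(\<Sum>A\<in>S. c A * (if closed A then \<nu> A else 0)) \<le> 1" by simp
qed

text \<open>The pointwise inequality between indicators is integrated against the core measure,
  which dominates \<open>\<nu>\<close> on every \<open>A i\<close>.\<close>

lemma core_imp_balanced:
  fixes \<nu> :: "'a::t2_space set \<Rightarrow> real"
  assumes "\<mu> \<in> core \<nu>"
  shows "balanced \<nu>"
  unfolding balanced_def
proof (intro allI impI)
  fix n :: nat and c :: "nat \<Rightarrow> real" and A :: "nat \<Rightarrow> 'a set"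
  assume cA: "\<forall>i\<in>{1..n}. 0 \<le> c i \<and> closed (A i)"
    and le_1: "\<forall>x. (\<Sum>i=1..n. c i * indicator (A i) x) \<le> 1"
  interpret prob_space \<mu> using assms by (simp add: core_def)
  have sets: "sets \<mu> = sets borel" and dom: "\<And>A. closed A \<Longrightarrow> \<nu> A \<le> prob A"
    using assms by (auto simp: core_def regular_borel_measure_def)
  have meas: "A i \<in> events" if "i \<in> {1..n}" for i using cA that by (simp add: sets)
  have "(\<Sum>i=1..n. c i * \<nu> (A i)) \<le> (\<Sum>i=1..n. c i * prob (A i))"
    using cA dom by (intro sum_mono mult_left_mono) auto
  also have "\<dots> = (\<Sum>i=1..n. expectation (\<lambda>x. c i * indicator (A i) x))"
    using meas by (intro sum.cong refl) (simp add: emeasure_eq_measure)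
  also have "\<dots> = expectation (\<lambda>x. \<Sum>i=1..n. c i * indicator (A i) x)"
    using meas by (intro Bochner_Integration.integral_sum[symmetric])
      (simp add: integrable_real_indicator emeasure_eq_measure)
  also have "\<dots> \<le> expectation (\<lambda>_. 1)"
    using meas le_1
    by (intro integral_mono Bochner_Integration.integrable_sum)
      (auto simp: integrable_real_indicator emeasure_eq_measure)
  finally show "(\<Sum>i=1..n. c i * \<nu> (A i)) \<le> 1" by (simp add: prob_space)
qed

theorem theorem1:
  fixes \<nu> :: "'a::t2_space set \<Rightarrow> real"
  assumes "compact (UNIV :: 'a set)"
    and "usc_capacity \<nu>"
  shows "core \<nu> \<noteq> {} \<longleftrightarrow> balanced \<nu>"
proof
  assume "core \<nu> \<noteq> {}"
  then show "balanced \<nu>" using core_imp_balanced by blast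
next
  assume "balanced \<nu>"
  from balanced_game_dominated_by_charge[OF balanced_game_extension[OF this]]
  obtain m where m: "\<And>A. (if closed A then \<nu> A else 0) \<le> m A" "m UNIV = 1"
    "\<And>A B. A \<inter> B = {} \<Longrightarrow> m (A \<union> B) = m A + m B"
    by blast
  \<comment> \<open>The default value \<open>0\<close> off the closed sets makes \<open>m\<close>
    nonnegative on every set, as the locale requires.\<close>
  have nonneg: "0 \<le> m A" for A
    using m(1)[of A] assms(2) unfolding usc_capacity_def by (auto split: if_splits intro: order_trans)
  interpret charge_on_compactum m
    by unfold_locales (use assms(1) nonneg m(2,3) in auto)
  have "\<nu> A \<le> measure radon A" if "closed A" for A
    using m(1)[of A] le_measure_radon[OF that] that by simp
  then have "radon \<in> core \<nu>"
    using prob_space_radon regular_radon by (simp add: core_def)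
  then show "core \<nu> \<noteq> {}" by blast
qed

end
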